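(* Given an invertible transducer $\mathcal{A}=(Q,A,\cdot,\circ)$ with $G=\mathcal{G}(\mathcal{A})$, the following algorithmic question is decidable. Input: an integer $\ell$. Output: is there an element $\underline{v}\in A^{\omega}$ of the boundary whose Schreier graph $\mathrm{Sch}(\mathrm{Stab}_G(\underline v),Q\cup Q^{-1})$ satisfies $\|\mathrm{Sch}(\mathrm{Stab}_G(\underline v),Q\cup Q^{-1})\|\le \ell$?
   Context: A transducer $\mathcal{A}=(Q,A,\cdot,\circ)$ consists of a finite set $Q$ of states, a finite alphabet $A$, a transition map $Q\times A\to Q$, $(q,a)\mapsto q\cdot a$, and an output map $Q\times A\to A$, $(q,a)\mapsto q\circ a$. Each state $q$ acts on finite words $A^{*}$ and on right-infinite words $A^\omega$ by $q\circ(a_1a_2\ldots)=(q\circ a_1)\,((q\cdot a_1)\circ(a_2\ldots))$. $\mathcal{A}$ is invertible if for each $q$ the map $a\mapsto q\circ a$ is a permutation of $A$; then the states act by automorphisms of the rooted tree $A^*$ and generate a group $\mathcal{G}(\mathcal{A})$, which also acts on the boundary $A^\omega$. For $\underline v\in A^\omega$, the Schreier graph of $\mathrm{Stab}_G(\underline v)=\{g\in G:g(\underline v)=\underline v\}$ is identified with the orbital graph of $\underline v$: its vertices are the points of the orbit $G\underline v$ and there is an edge labelled $s$ from $\underline w$ to $s(\underline w)$ for each $s\in Q\cup Q^{-1}$. $\|\cdot\|$ denotes the number of vertices, i.e. the cardinality of the orbit of $\underline v$. *)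

theory Defs
  imports
    "HOL-Library.Stream"
    "HOL-Library.Nat_Bijection"
    "HOL-Algebra.Generated_Groups"
    "HOL-Algebra.Group_Action"
    "Graph_Theory.Digraph"
begin

section \<open>Recursive functions and decidable problems\<close>

text \<open>
  The total (general) recursive functions of \<open>n\<close> arguments: the least class containing the
  constant zero function, the successor and the projections and closed under composition, primitive
  recursion and minimization of regular functions. Argument tuples are lists; only the values on
  lists of length \<open>n\<close> are meaningful.
\<close>

inductive recursive_fn :: "nat \<Rightarrow> (nat list \<Rightarrow> nat) \<Rightarrow> bool" where
  zero: "recursive_fn n (\<lambda>_. 0)"
| succ: "recursive_fn 1 (\<lambda>xs. Suc (xs ! 0))"
| proj: "i < n \<Longrightarrow> recursive_fn n (\<lambda>xs. xs ! i)"
| comp: "recursive_fn (length gs) f \<Longrightarrow> (\<forall>g\<in>set gs. recursive_fn n g) \<Longrightarrow>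
    recursive_fn n (\<lambda>xs. f (map (\<lambda>g. g xs) gs))"
| prec: "recursive_fn n f \<Longrightarrow> recursive_fn (n + 2) g \<Longrightarrow>
    recursive_fn (n + 1) (\<lambda>xs. rec_nat (f (tl xs)) (\<lambda>k r. g (k # r # tl xs)) (hd xs))"
| minim: "recursive_fn (n + 1) f \<Longrightarrow> (\<forall>xs. length xs = n \<longrightarrow> (\<exists>k. f (k # xs) = 0)) \<Longrightarrow>
    recursive_fn n (\<lambda>xs. LEAST k. f (k # xs) = 0)"

text \<open>
  A decision problem is given by a set \<open>I\<close> of admissible inputs, an encoding \<open>enc\<close> of the inputs as
  natural numbers, and the question \<open>P\<close>. The algorithm has to answer correctly on admissible inputs.
\<close>

definition decidable_problem :: "'i set \<Rightarrow> ('i \<Rightarrow> nat) \<Rightarrow> ('i \<Rightarrow> bool) \<Rightarrow> bool" where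
  "decidable_problem I enc P \<longleftrightarrow>
    (\<exists>f. recursive_fn 1 f \<and> (\<forall>x\<in>I. f [enc x] = (if P x then 1 else 0)))"

section \<open>Transducers\<close>

record ('q, 'a) transducer =
  states :: "'q set"
  letters :: "'a set"
  step :: "'q \<Rightarrow> 'a \<Rightarrow> 'q"
  emit :: "'q \<Rightarrow> 'a \<Rightarrow> 'a"

definition is_transducer :: "('q, 'a) transducer \<Rightarrow> bool" where
  "is_transducer T \<longleftrightarrow> finite (states T) \<and> finite (letters T) \<and>
    (\<forall>q\<in>states T. \<forall>a\<in>letters T. step T q a \<in> states T \<and> emit T q a \<in> letters T)"

definition invertible_transducer :: "('q, 'a) transducer \<Rightarrow> bool" where
  "invertible_transducer T \<longleftrightarrow> is_transducer T \<and>
    (\<forall>q\<in>states T. bij_betw (emit T q) (letters T) (letters T))"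

primrec word_action :: "('q, 'a) transducer \<Rightarrow> 'q \<Rightarrow> 'a list \<Rightarrow> 'a list" where
  "word_action T q [] = []"
| "word_action T q (a # w) = emit T q a # word_action T (step T q a) w"

primcorec stream_action :: "('q, 'a) transducer \<Rightarrow> 'q \<Rightarrow> 'a stream \<Rightarrow> 'a stream" where
  "stream_action T q v = emit T q (shd v) ## stream_action T (step T q (shd v)) (stl v)"

section \<open>The automaton group and its action on the boundary\<close>

definition state_perm :: "('q, 'a) transducer \<Rightarrow> 'q \<Rightarrow> ('a list \<Rightarrow> 'a list)" where
  "state_perm T q = restrict (word_action T q) (lists (letters T))"

definition automaton_group :: "('q, 'a) transducer \<Rightarrow> ('a list \<Rightarrow> 'a list) monoid" where
  "automaton_group T =
    subgroup_generated (BijGroup (lists (letters T))) (state_perm T ` states T)"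

text \<open>
  An automorphism of the rooted tree of finite words preserves lengths and prefixes; the
  \<open>n\<close>-th letter of the image of an infinite word \<open>v\<close> is thus the \<open>n\<close>-th letter of the image of any
  prefix of \<open>v\<close> of length at least \<open>n + 1\<close>.
\<close>

definition boundary_action ::
    "('q, 'a) transducer \<Rightarrow> ('a list \<Rightarrow> 'a list) \<Rightarrow> 'a stream \<Rightarrow> 'a stream" where
  "boundary_action T g =
    (\<lambda>v\<in>streams (letters T). smap (\<lambda>n. g (stake (Suc n) v) ! n) nats)"

text \<open>
  The elements of \<open>Q \<union> Q\<inverse>\<close>, viewed as formal symbols: \<open>Inl q\<close> is \<open>q\<close> and \<open>Inr q\<close> is \<open>q\<inverse>\<close>.
\<close>

definition symbol_perm :: "('q, 'a) transducer \<Rightarrow> 'q + 'q \<Rightarrow> ('a list \<Rightarrow> 'a list)" where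
  "symbol_perm T s =
    (case s of Inl q \<Rightarrow> state_perm T q | Inr q \<Rightarrow> inv\<^bsub>automaton_group T\<^esub> (state_perm T q))"

text \<open>
  The Schreier graph of the stabilizer of \<open>v\<close>, as the orbital graph of \<open>v\<close>. An arc is a triple of
  its tail, its label and its head.
\<close>

definition schreier_graph ::
    "('q, 'a) transducer \<Rightarrow> 'a stream \<Rightarrow> ('a stream, 'a stream \<times> ('q + 'q) \<times> 'a stream) pre_digraph"
  where
  "schreier_graph T v =
    \<lparr>verts = orbit (automaton_group T) (boundary_action T) v,
     arcs = {(w, s, boundary_action T (symbol_perm T s) w) | w s.
       w \<in> orbit (automaton_group T) (boundary_action T) v \<and> s \<in> states T <+> states T},
     tail = (\<lambda>(w, s, w'). w),
     head = (\<lambda>(w, s, w'). w')\<rparr>"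

definition norm_le :: "('v, 'e) pre_digraph \<Rightarrow> int \<Rightarrow> bool" where
  "norm_le \<Gamma> l \<longleftrightarrow> finite (verts \<Gamma>) \<and> int (card (verts \<Gamma>)) \<le> l"

definition has_small_schreier_graph :: "('q, 'a) transducer \<Rightarrow> int \<Rightarrow> bool" where
  "has_small_schreier_graph T l \<longleftrightarrow>
    (\<exists>v\<in>streams (letters T). norm_le (schreier_graph T v) l)"

section \<open>Transducers as inputs of algorithms\<close>

text \<open>
  The position of \<open>x\<close> in a duplicate-free list containing \<open>x\<close>.
\<close>

definition position :: "'b list \<Rightarrow> 'b \<Rightarrow> nat" where
  "position xs x = length (takeWhile (\<lambda>y. y \<noteq> x) xs)"

text \<open>
  A transducer is input through its tables with respect to enumerations \<open>qs\<close> of the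
  states and \<open>as\<close> of the letters.
\<close>

definition enumerates :: "'b list \<Rightarrow> 'b set \<Rightarrow> bool" where
  "enumerates xs X \<longleftrightarrow> distinct xs \<and> set xs = X"

definition transducer_code :: "('q, 'a) transducer \<Rightarrow> 'q list \<Rightarrow> 'a list \<Rightarrow> nat" where
  "transducer_code T qs as = list_encode (length qs # length as #
    concat (map (\<lambda>(q, a). [position qs (step T q a), position as (emit T q a)])
      (List.product qs as)))"

section \<open>Agreement of the definitions with one another\<close>

lemma length_word_action [simp]: "length (word_action T q w) = length w"
  by (induction w arbitrary: q) auto

lemma take_word_action: "take n (word_action T q w) = word_action T q (take n w)"
proof (induction w arbitrary: q n)
  case (Cons a w)
  then show ?case by (cases n) auto
qed simp

lemma word_action_in_lists:
  assumes "is_transducer T" "q \<in> states T" "w \<in> lists (letters T)"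
  shows "word_action T q w \<in> lists (letters T)"
  using assms(3,2)
proof (induction w arbitrary: q)
  case (Cons a w)
  then show ?case using assms(1) by (auto simp: is_transducer_def)
qed simp

lemma word_action_bij:
  assumes T: "invertible_transducer T" and q: "q \<in> states T"
  shows "bij_betw (word_action T q) (lists (letters T)) (lists (letters T))"
proof -
  have tr: "is_transducer T" using T by (simp add: invertible_transducer_def)
  have b: "bij_betw (emit T p) (letters T) (letters T)" if "p \<in> states T" for p
    using T that by (simp add: invertible_transducer_def)
  have "w = w'" if "word_action T p w = word_action T p w'" "p \<in> states T"
    "w \<in> lists (letters T)" "w' \<in> lists (letters T)" for p w w'
    using that(3,1,2,4)
  proof (induction w arbitrary: p w')
    case Nil
    then show ?case by (cases w') auto
  next
    case (Cons a w)
    then obtain a' u where w': "w' = a' # u" by (cases w') auto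
    with Cons.prems Cons.hyps b[of p] have "a = a'" by (auto simp: bij_betw_def dest: inj_onD)
    then show ?case using Cons w' tr by (auto simp: is_transducer_def)
  qed
  then have "inj_on (word_action T q) (lists (letters T))" using q by (intro inj_onI) blast
  moreover have "\<exists>w\<in>lists (letters T). word_action T p w = u"
    if "u \<in> lists (letters T)" "p \<in> states T" for u p
    using that
  proof (induction u arbitrary: p)
    case (Cons c u)
    then obtain a where a: "a \<in> letters T" "emit T p a = c"
      using b[of p] by (metis bij_betw_def imageE)
    then have "step T p a \<in> states T" using tr Cons.prems by (auto simp: is_transducer_def)
    then obtain w where "w \<in> lists (letters T)" "word_action T (step T p a) w = u"
      using Cons.IH by blast
    then show ?case using a by (intro bexI[of _ "a # w"]) auto
  qed (auto intro: bexI[of _ "[]"])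
  ultimately show ?thesis
    using q word_action_in_lists[OF tr q] by (fastforce simp: bij_betw_def)
qed

lemma state_perm_in_carrier:
  assumes "invertible_transducer T" "q \<in> states T"
  shows "state_perm T q \<in> carrier (BijGroup (lists (letters T)))"
proof -
  have "bij_betw (state_perm T q) (lists (letters T)) (lists (letters T))"
    using word_action_bij[OF assms]
    by (rule bij_betw_cong[THEN iffD1, rotated]) (simp add: state_perm_def)
  then show ?thesis by (simp add: BijGroup_def Bij_def state_perm_def)
qed

lemma carrier_automaton_group:
  assumes "invertible_transducer T"
  shows "carrier (automaton_group T) =
    generate (BijGroup (lists (letters T))) (state_perm T ` states T)"
proof -
  have "carrier (BijGroup (lists (letters T))) \<inter> state_perm T ` states T = state_perm T ` states T"
    using state_perm_in_carrier[OF assms] by blast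
  then show ?thesis by (simp add: automaton_group_def carrier_subgroup_generated)
qed

lemma group_automaton_group: "group (automaton_group T)"
  unfolding automaton_group_def by (rule group.group_subgroup_generated[OF group_BijGroup])

lemma snth_boundary_action:
  "v \<in> streams (letters T) \<Longrightarrow> boundary_action T g v !! n = g (stake (Suc n) v) ! n"
  by (simp add: boundary_action_def)

lemma snth_stream_action:
  "stream_action T q v !! n = word_action T q (stake (Suc n) v) ! n"
proof (induction n arbitrary: q v)
  case (Suc n)
  then show ?case by (simp del: stake.simps(2) add: stake.simps(2)[of "Suc n"])
qed simp

lemma stake_in_lists: "v \<in> streams X \<Longrightarrow> stake n v \<in> lists X"
  by (induction n arbitrary: v) (auto simp: streams_shd streams_stl)

lemma boundary_action_state:
  assumes "v \<in> streams (letters T)"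
  shows "boundary_action T (state_perm T q) v = stream_action T q v"
proof -
  have "boundary_action T (state_perm T q) v !! n = stream_action T q v !! n" for n
    using snth_boundary_action[OF assms] stake_in_lists[OF assms, of "Suc n"]
    by (simp del: stake.simps add: state_perm_def snth_stream_action)
  then show ?thesis by (metis stream.map_cong0 stream_smap_nats)
qed

definition tree_map :: "'a set \<Rightarrow> ('a list \<Rightarrow> 'a list) \<Rightarrow> bool" where
  "tree_map X g \<longleftrightarrow> (\<forall>w\<in>lists X. g w \<in> lists X \<and> length (g w) = length w \<and>
    (\<forall>n. take n (g w) = g (take n w)))"

lemma take_in_lists: "w \<in> lists X \<Longrightarrow> take n w \<in> lists X"
  by (auto dest: in_set_takeD)

lemma automaton_group_tree_map:
  assumes T: "invertible_transducer T" and g: "g \<in> carrier (automaton_group T)"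
  shows "g \<in> Bij (lists (letters T)) \<and> tree_map (letters T) g"
  using g unfolding carrier_automaton_group[OF T]
proof (induction rule: generate.induct)
  case one
have "\<one>\<^bsub>BijGroup (lists (letters T))\<^esub> = (\<lambda>w\<in>lists (letters T). w)"
    by (simp add: BijGroup_def)
  moreover have "tree_map (letters T) (\<lambda>w\<in>lists (letters T). w)"
    using take_in_lists[of _ "letters T"] unfolding tree_map_def by simp
  ultimately show ?case using id_Bij by metis
next
  case (incl h)
  then obtain q where q: "q \<in> states T" "h = state_perm T q" by blast
  have "is_transducer T" using T by (simp add: invertible_transducer_def)
  then have "tree_map (letters T) h"
    unfolding tree_map_def q(2) state_perm_def
    using word_action_in_lists[OF _ q(1)] take_in_lists take_word_action
    by (metis length_word_action restrict_apply')
  then show ?case using state_perm_in_carrier[OF T q(1)] q by (simp add: BijGroup_def)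
next
  case (inv h)
  then obtain q where q: "q \<in> states T" "h = state_perm T q" by blast
  let ?L = "lists (letters T)"
  have tr: "is_transducer T" using T by (simp add: invertible_transducer_def)
  have hB: "h \<in> Bij ?L" using state_perm_in_carrier[OF T q(1)] q by (simp add: BijGroup_def)
  then have hb: "bij_betw h ?L ?L" by (simp add: Bij_def)
  have hh: "length (h w) = length w" "take n (h w) = h (take n w)" if "w \<in> ?L" for w n
    using that take_in_lists[OF that] take_word_action
    unfolding q(2) state_perm_def by (metis length_word_action restrict_apply')+
  have "tree_map (letters T) (restrict (inv_into ?L h) ?L)"
    unfolding tree_map_def
  proof (intro ballI conjI allI)
    fix w n assume w: "w \<in> ?L"
    define u where "u = inv_into ?L h w"
    have u: "u \<in> ?L" "h u = w"
      using w hb by (auto simp: u_def bij_betw_def inv_into_into f_inv_into_f)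
    have e: "restrict (inv_into ?L h) ?L w = u" using w by (simp add: u_def)
    show "restrict (inv_into ?L h) ?L w \<in> ?L" using e u by simp
    show "length (restrict (inv_into ?L h) ?L w) = length w" using e u hh by metis
    have "inv_into ?L h (take n w) = take n u"
      using hh(2)[OF u(1)] u(2) hb take_in_lists[OF u(1)] by (metis bij_betw_def inv_into_f_f)
    then show "take n (restrict (inv_into ?L h) ?L w) = restrict (inv_into ?L h) ?L (take n w)"
      using e take_in_lists[OF w] by (metis restrict_apply')
  qed
  then show ?case using restrict_inv_into_Bij[OF hB] inv_BijGroup[OF hB] by metis
next
  case (eng h1 h2)
  then have m: "h1 \<otimes>\<^bsub>BijGroup (lists (letters T))\<^esub> h2 = compose (lists (letters T)) h1 h2"
    by (simp add: BijGroup_def)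
  have "tree_map (letters T) (compose (lists (letters T)) h1 h2)"
    using eng take_in_lists unfolding tree_map_def compose_def
    by (metis (no_types, lifting) restrict_apply')
  then show ?case using eng m by (simp add: compose_Bij)
qed

lemma stake_boundary_action:
  assumes "tree_map (letters T) g" "v \<in> streams (letters T)"
  shows "stake n (boundary_action T g v) = g (stake n v)"
proof (rule nth_equalityI)
  have L: "stake n v \<in> lists (letters T)" by (rule stake_in_lists[OF assms(2)])
  then have len: "length (g (stake n v)) = n" using assms(1) by (simp add: tree_map_def)
  then show "length (stake n (boundary_action T g v)) = length (g (stake n v))" by simp
  fix i assume "i < length (stake n (boundary_action T g v))"
  then have i: "i < n" by simp
  have "take (Suc i) (g (stake n v)) = g (take (Suc i) (stake n v))"
    using assms(1) L by (simp add: tree_map_def)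
  also have "take (Suc i) (stake n v) = stake (Suc i) v"
    using i by (simp add: take_stake min_def del: stake.simps)
  finally have "g (stake n v) ! i = g (stake (Suc i) v) ! i"
    by (metis lessI nth_take)
  then show "stake n (boundary_action T g v) ! i = g (stake n v) ! i"
    using i snth_boundary_action[OF assms(2)] by (simp del: stake.simps)
qed

lemma streams_eqI: "(\<And>n. stake n v = stake n w) \<Longrightarrow> v = w"
  by (metis stream.map_cong0 stream_smap_nats stake_nth lessI)

lemma boundary_action_in_streams:
  assumes "tree_map (letters T) g" "v \<in> streams (letters T)"
  shows "boundary_action T g v \<in> streams (letters T)"
proof -
  have "boundary_action T g v !! n \<in> letters T" for n
  proof -
    have "stake (Suc n) (boundary_action T g v) \<in> lists (letters T)"
      using stake_boundary_action[OF assms] stake_in_lists[OF assms(2)] assms(1)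
      by (simp add: tree_map_def del: stake.simps)
    then show ?thesis
      by (metis in_lists_conv_set length_stake lessI nth_mem stake_nth)
  qed
  then show ?thesis by (simp add: streams_iff_snth)
qed

lemma boundary_action_mult:
  assumes T: "invertible_transducer T"
    and g: "g \<in> carrier (automaton_group T)" and h: "h \<in> carrier (automaton_group T)"
    and v: "v \<in> streams (letters T)"
  shows "boundary_action T (g \<otimes>\<^bsub>automaton_group T\<^esub> h) v =
    boundary_action T g (boundary_action T h v)"
proof (rule streams_eqI)
  fix n
  note G = automaton_group_tree_map[OF T]
  have gh: "g \<otimes>\<^bsub>automaton_group T\<^esub> h \<in> carrier (automaton_group T)"
    using group_automaton_group g h by (meson group.is_monoid monoid.m_closed)
  have "g \<otimes>\<^bsub>automaton_group T\<^esub> h = compose (lists (letters T)) g h"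
    using G[OF g] G[OF h] by (simp add: automaton_group_def BijGroup_def)
  then show "stake n (boundary_action T (g \<otimes>\<^bsub>automaton_group T\<^esub> h) v) =
    stake n (boundary_action T g (boundary_action T h v))"
    using G[OF g] G[OF h] G[OF gh] v stake_in_lists[OF v]
    by (simp add: stake_boundary_action boundary_action_in_streams[of T h v] compose_def)
qed

lemma boundary_action_one:
  assumes "v \<in> streams (letters T)"
  shows "boundary_action T \<one>\<^bsub>automaton_group T\<^esub> v = v"
proof (rule streams_eqI)
  fix n
  have "tree_map (letters T) \<one>\<^bsub>automaton_group T\<^esub>"
    by (auto simp: automaton_group_def BijGroup_def tree_map_def take_in_lists dest: in_set_takeD)
  then show "stake n (boundary_action T \<one>\<^bsub>automaton_group T\<^esub> v) = stake n v"
    using assms stake_in_lists[OF assms]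
    by (simp add: stake_boundary_action automaton_group_def BijGroup_def)
qed

theorem boundary_group_action:
  assumes T: "invertible_transducer T"
  shows "group_action (automaton_group T) (streams (letters T)) (boundary_action T)"
proof -
  let ?G = "automaton_group T" and ?S = "streams (letters T)"
  interpret G: group ?G by (rule group_automaton_group)
  have in_S: "boundary_action T g v \<in> ?S" if "g \<in> carrier ?G" "v \<in> ?S" for g v
    using that automaton_group_tree_map[OF T] boundary_action_in_streams by blast
  have B: "boundary_action T g \<in> Bij ?S" if g: "g \<in> carrier ?G" for g
  proof -
    have "bij_betw (boundary_action T g) ?S ?S"
      by (rule bij_betw_byWitness[where f' = "boundary_action T (inv\<^bsub>?G\<^esub> g)"])
        (use g in \<open>auto simp: in_S boundary_action_mult[OF T, symmetric] boundary_action_one\<close>)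
    then show ?thesis by (simp add: Bij_def boundary_action_def)
  qed
  have "boundary_action T \<in> hom ?G (BijGroup ?S)"
  proof (rule homI)
    fix g h assume gh: "g \<in> carrier ?G" "h \<in> carrier ?G"
    show "boundary_action T (g \<otimes>\<^bsub>?G\<^esub> h) =
      boundary_action T g \<otimes>\<^bsub>BijGroup ?S\<^esub> boundary_action T h"
    proof
      fix v
      show "boundary_action T (g \<otimes>\<^bsub>?G\<^esub> h) v =
        (boundary_action T g \<otimes>\<^bsub>BijGroup ?S\<^esub> boundary_action T h) v"
        using gh B by (cases "v \<in> ?S")
          (simp_all add: BijGroup_def compose_def boundary_action_mult[OF T],
           simp add: boundary_action_def)
    qed
  qed (use B in \<open>simp add: BijGroup_def\<close>)
  then show ?thesis
    by (simp add: group_action_def group_hom_def group_hom_axioms_def group_BijGroup G.is_group)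
qed

end

theory Submission
  imports Defs
begin

text \<open>
  Fix \<open>l > 0\<close>. A point with at most \<open>l\<close> images under the group exists iff there are \<open>l\<close> infinite
  words \<open>v\<^sub>0, \<dots>, v\<^sub>l\<^sub>-\<^sub>1\<close>, repetitions allowed, and an index map \<open>\<pi>\<close> such that every state \<open>q\<close> sends
  \<open>v\<^sub>i\<close> to \<open>v\<^bsub>\<pi> q i\<^esub>\<close>: list an orbit to obtain the family; conversely the family is a finite
  set into which every state maps injectively, hence bijectively, so that it is closed under the
  inverses as well and contains the orbit of \<open>v\<^sub>0\<close> (\<open>has_small_schreier_graph_iff_family\<close>).

  Such a family can be checked letter by letter. Reading the \<open>t\<close>-th letters of all \<open>v\<^sub>i\<close> at once, one
  only has to remember the section \<open>\<sigma> t q i\<close> of each \<open>q\<close> at the prefix of length \<open>t\<close> of \<open>v\<^sub>i\<close>.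
  The matrix \<open>(\<sigma> t q i)\<close>, indexed by \<open>q\<close> and \<open>i\<close>, takes at most \<open>N = \<bar>Q\<bar>\<^bsup>\<bar>Q\<bar> l\<^esup>\<close> values, so a run
  of length \<open>N\<close> visits one of them twice, and going round the loop between the two visits for ever
  produces infinite words (\<open>invariant_run_pumping\<close>). Hence a point with a small orbit
  exists iff there is a run of length \<open>N\<close>, which is a finite search with a computable bound.

  To see that this search is a recursive function, a run is written as three natural numbers, the
  digits of which, in the bases \<open>l\<close>, \<open>\<bar>A\<bar>\<close> and \<open>\<bar>Q\<bar>\<close>, are the values of \<open>\<pi>\<close>, the letters and the sections
  (\<open>ex_digit_run_iff\<close>). Being a run becomes a formula in which all quantifiers are bounded and
  all terms are built from arithmetic and table lookup. The class of recursive functions is closed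
  under all of these (\<open>decidable_has_coded_run\<close>). The algorithm reads the transducer from its tables, so
  it is uniform in the transducer; the version for a fixed one hard-wires these tables.
\<close>

section \<open>Closure properties of recursive functions\<close>

text \<open>
  Recursive functions are specific functions on lists, whose values on lists of a wrong length are
  accidental. Considering them up to their values on lists of the right length makes
  the class invariant under rewriting.
\<close>


definition computable :: "nat \<Rightarrow> (nat list \<Rightarrow> nat) \<Rightarrow> bool" where
  "computable n f \<longleftrightarrow> (\<exists>g. recursive_fn n g \<and> (\<forall>xs. length xs = n \<longrightarrow> g xs = f xs))"

definition decidable :: "nat \<Rightarrow> (nat list \<Rightarrow> bool) \<Rightarrow> bool" where
  "decidable n P \<longleftrightarrow> computable n (\<lambda>xs. of_bool (P xs))"

lemma computable_cong:
  assumes "computable n f" "\<And>xs. length xs = n \<Longrightarrow> f xs = g xs"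
  shows "computable n g"
  using assms unfolding computable_def by metis

lemma recursive_fn_computable: "recursive_fn n f \<Longrightarrow> computable n f"
  unfolding computable_def by blast

lemma computable_nth: "i < n \<Longrightarrow> computable n (\<lambda>xs. xs ! i)"
  by (rule recursive_fn_computable[OF recursive_fn.proj])

lemma computable_hd: "computable (Suc n) (\<lambda>xs. hd xs)"
  by (rule computable_cong[OF computable_nth[of 0]]) (auto simp: length_Suc_conv)

lemma computable_compose:
  assumes f: "computable (length gs) f" and gs: "\<forall>g\<in>set gs. computable n g"
  shows "computable n (\<lambda>xs. f (map (\<lambda>g. g xs) gs))"
proof -
  obtain f' where f': "recursive_fn (length gs) f'" "\<And>xs. length xs = length gs \<Longrightarrow> f' xs = f xs"
    using f unfolding computable_def by blast
  obtain h where h: "\<And>g. g \<in> set gs \<Longrightarrow> recursive_fn n (h g)"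
      "\<And>g xs. g \<in> set gs \<Longrightarrow> length xs = n \<Longrightarrow> h g xs = g xs"
    using gs unfolding computable_def by metis
  have "recursive_fn n (\<lambda>xs. f' (map (\<lambda>g. g xs) (map h gs)))"
    using f'(1) h(1) by (intro recursive_fn.comp) auto
  moreover have "f' (map (\<lambda>g. g xs) (map h gs)) = f (map (\<lambda>g. g xs) gs)" if "length xs = n" for xs
  proof -
    have "map (\<lambda>g. g xs) (map h gs) = map (\<lambda>g. g xs) gs" using h(2) that by (simp add: comp_def)
    then show ?thesis using f'(2)[of "map (\<lambda>g. g xs) gs"] by (simp only: length_map)
  qed
  ultimately show ?thesis unfolding computable_def by blast
qed

text \<open>
  Argument lists serve as environments of de Bruijn indices: a bound variable is the head of the list,
  and \<open>computable_weaken\<close> shifts a term under a binder. In this form the closure properties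
  below are introduction rules that decompose a term together with its bound variables.
\<close>

lemma computable_weaken:
  assumes "computable n f"
  shows "computable (Suc n) (\<lambda>xs. f (tl xs))"
proof (rule computable_cong)
  let ?gs = "map (\<lambda>i xs. xs ! Suc i) [0..<n]"
  show "computable (Suc n) (\<lambda>xs. f (map (\<lambda>g. g xs) ?gs))"
    using assms by (intro computable_compose) (auto intro: computable_nth)
  show "f (map (\<lambda>g. g xs) ?gs) = f (tl xs)" if "length xs = Suc n" for xs
    using that by (intro arg_cong[of _ _ f] nth_equalityI) (auto simp: nth_tl)
qed

lemma computable_bind:
  assumes "computable n b" and "computable (Suc n) (\<lambda>ys. h (hd ys) (tl ys))"
  shows "computable n (\<lambda>xs. h (b xs) xs)"
proof (rule computable_cong)
  let ?gs = "b # map (\<lambda>i xs. xs ! i) [0..<n]"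
  show "computable n (\<lambda>xs. (\<lambda>ys. h (hd ys) (tl ys)) (map (\<lambda>g. g xs) ?gs))"
    using assms by (intro computable_compose) (auto intro: computable_nth)
  show "(\<lambda>ys. h (hd ys) (tl ys)) (map (\<lambda>g. g xs) ?gs) = h (b xs) xs" if "length xs = n" for xs
    using that map_nth[of xs] by (simp add: comp_def)
qed

lemma computable_Suc:
  assumes "computable n f"
  shows "computable n (\<lambda>xs. Suc (f xs))"
  using computable_compose[of "[f]" "\<lambda>xs. Suc (xs ! 0)" n] assms
    recursive_fn_computable[OF recursive_fn.succ]
  by simp

lemma computable_const: "computable n (\<lambda>_. k)"
  by (induction k) (auto intro: computable_Suc recursive_fn_computable recursive_fn.zero)

lemma computable_rec_nat:
  assumes f: "computable n f" and b: "computable n b"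
    and h: "computable (Suc (Suc n)) (\<lambda>ys. h (hd ys) (hd (tl ys)) (tl (tl ys)))"
  shows "computable n (\<lambda>xs. rec_nat (f xs) (\<lambda>k r. h k r xs) (b xs))"
proof (rule computable_bind[OF b])
  obtain f' where f': "recursive_fn n f'" "\<And>xs. length xs = n \<Longrightarrow> f' xs = f xs"
    using f unfolding computable_def by blast
  obtain g where g: "recursive_fn (n + 2) g"
      "\<And>ys. length ys = n + 2 \<Longrightarrow> g ys = h (hd ys) (hd (tl ys)) (tl (tl ys))"
    using h unfolding computable_def by auto
  have rec_eq: "rec_nat (f' xs) (\<lambda>k r. g (k # r # xs)) m = rec_nat (f xs) (\<lambda>k r. h k r xs) m"
    if "length xs = n" for xs m
    using that f'(2) g(2) by (induction m) simp_all
  show "computable (Suc n) (\<lambda>ys. rec_nat (f (tl ys)) (\<lambda>k r. h k r (tl ys)) (hd ys))"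
    by (rule computable_cong[OF recursive_fn_computable[OF
          recursive_fn.prec[OF f'(1) g(1), unfolded Suc_eq_plus1[symmetric]]]])
      (simp add: rec_eq)
qed

lemma computable_add: "computable n a \<Longrightarrow> computable n b \<Longrightarrow> computable n (\<lambda>xs. a xs + b xs)"
proof -
  assume ab: "computable n a" "computable n b"
  have e: "a + b = rec_nat a (\<lambda>k r. Suc r) b" for a b :: nat by (induction b) auto
  show ?thesis unfolding e
    by (intro computable_rec_nat ab computable_Suc computable_hd computable_weaken)
qed

lemma computable_mult: "computable n a \<Longrightarrow> computable n b \<Longrightarrow> computable n (\<lambda>xs. a xs * b xs)"
proof -
  assume ab: "computable n a" "computable n b"
  have e: "a * b = rec_nat 0 (\<lambda>k r. r + a) b" for a b :: nat by (induction b) auto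
  show ?thesis unfolding e
    by (intro computable_rec_nat ab computable_add computable_const computable_hd computable_weaken)
qed

lemma computable_power: "computable n a \<Longrightarrow> computable n b \<Longrightarrow> computable n (\<lambda>xs. a xs ^ b xs)"
proof -
  assume ab: "computable n a" "computable n b"
  have e: "a ^ b = rec_nat 1 (\<lambda>k r. r * a) b" for a b :: nat by (induction b) auto
  show ?thesis unfolding e
    by (intro computable_rec_nat ab computable_mult computable_const computable_hd computable_weaken)
qed

lemma computable_diff: "computable n a \<Longrightarrow> computable n b \<Longrightarrow> computable n (\<lambda>xs. a xs - b xs)"
proof -
  assume ab: "computable n a" "computable n b"
  have p: "m - 1 = rec_nat 0 (\<lambda>k r. k) m" for m :: nat by (induction m) auto
  have "computable n (\<lambda>xs. f xs - 1)" if "computable n f" for n f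
    unfolding p by (intro computable_rec_nat that computable_const computable_hd computable_weaken)
  note pred = this
  have e: "rec_nat a (\<lambda>k r. r - 1) b = a - b" for a b :: nat
    by (induction b) simp_all
  have "computable n (\<lambda>xs. rec_nat (a xs) (\<lambda>k r. r - 1) (b xs))"
    by (intro computable_rec_nat ab pred computable_hd computable_weaken)
  then show ?thesis by (simp only: e)
qed

lemma decidable_less: "computable n a \<Longrightarrow> computable n b \<Longrightarrow> decidable n (\<lambda>xs. a xs < b xs)"
proof -
  assume ab: "computable n a" "computable n b"
  have e: "of_bool (a < b) = 1 - (1 - (b - a))" for a b :: nat by auto
  show ?thesis unfolding decidable_def e
    by (intro computable_diff ab computable_const)
qed

lemma decidable_not: "decidable n P \<Longrightarrow> decidable n (\<lambda>xs. \<not> P xs)"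
proof -
  assume P: "decidable n P"
  have e: "of_bool (\<not> Q) = 1 - (of_bool Q :: nat)" for Q by simp
  show ?thesis unfolding decidable_def e
    by (intro computable_diff computable_const P[unfolded decidable_def])
qed

lemma decidable_conj: "decidable n P \<Longrightarrow> decidable n Q \<Longrightarrow> decidable n (\<lambda>xs. P xs \<and> Q xs)"
  unfolding decidable_def of_bool_conj by (rule computable_mult)

lemma decidable_disj: "decidable n P \<Longrightarrow> decidable n Q \<Longrightarrow> decidable n (\<lambda>xs. P xs \<or> Q xs)"
  using decidable_not[OF decidable_conj[OF decidable_not decidable_not]] by simp

lemma decidable_eq: 
  assumes "computable n a" "computable n b" shows "decidable n (\<lambda>xs. a xs = b xs)"
proof -
  have "decidable n (\<lambda>xs. \<not> a xs < b xs \<and> \<not> b xs < a xs)"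
    by (intro decidable_conj decidable_not decidable_less assms)
  then show ?thesis by (simp add: not_less eq_iff conj_commute)
qed

lemma decidable_all_less:
  assumes b: "computable n b" and P: "decidable (Suc n) (\<lambda>ys. P (hd ys) (tl ys))"
  shows "decidable n (\<lambda>xs. \<forall>k<b xs. P k xs)"
proof -
  have e: "(of_bool (\<forall>k<m. P k xs) :: nat) = rec_nat 1 (\<lambda>k r. r * of_bool (P k xs)) m" for m xs
  proof (induction m)
    case (Suc m)
    have "(\<forall>k<Suc m. P k xs) \<longleftrightarrow> (\<forall>k<m. P k xs) \<and> P m xs" by (auto simp: less_Suc_eq)
    then show ?case using Suc.IH by (simp only: of_bool_conj old.nat.simps)
  qed simp
  \<comment> \<open>Inside the recursion, the accumulator sits between the counter and the environment.\<close>
  have P': "computable (Suc (Suc n)) (\<lambda>ys. of_bool (P (hd ys) (tl (tl ys))))"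
  proof (rule computable_cong)
    let ?gs = "(\<lambda>ys. ys ! 0) # map (\<lambda>i ys. ys ! Suc (Suc i)) [0..<n]"
    show "computable (Suc (Suc n)) (\<lambda>ys. (\<lambda>zs. of_bool (P (hd zs) (tl zs))) (map (\<lambda>g. g ys) ?gs))"
      using P by (intro computable_compose) (auto simp: decidable_def intro: computable_nth)
    show "(\<lambda>zs. of_bool (P (hd zs) (tl zs))) (map (\<lambda>g. g ys) ?gs) = of_bool (P (hd ys) (tl (tl ys)))"
      if "length ys = Suc (Suc n)" for ys
    proof -
      have "map ((\<lambda>g. g ys) \<circ> (\<lambda>i ys. ys ! Suc (Suc i))) [0..<n] = tl (tl ys)"
        using that by (intro nth_equalityI) (auto simp: nth_tl)
      then show ?thesis using that by (cases ys) simp_all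
    qed
  qed
  show ?thesis
    unfolding decidable_def e
    by (intro computable_rec_nat b computable_mult computable_const P'
        computable_hd computable_weaken)
qed


lemma decidable_ex_less:
  assumes "computable n b" and "decidable (Suc n) (\<lambda>ys. P (hd ys) (tl ys))"
  shows "decidable n (\<lambda>xs. \<exists>k<b xs. P k xs)"
  using decidable_not[OF decidable_all_less[OF assms(1) decidable_not[OF assms(2)]]] by simp

lemma computable_Least:
  assumes P: "decidable (Suc n) (\<lambda>ys. P (hd ys) (tl ys))"
    and ex: "\<And>xs. length xs = n \<Longrightarrow> \<exists>k. P k xs"
  shows "computable n (\<lambda>xs. LEAST k. P k xs)"
proof -
  obtain g where g: "recursive_fn (n + 1) g"
      "\<And>ys. length ys = Suc n \<Longrightarrow> g ys = of_bool (\<not> P (hd ys) (tl ys))"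
    using decidable_not[OF P] unfolding decidable_def computable_def by auto
  have g0: "g (k # xs) = 0 \<longleftrightarrow> P k xs" if "length xs = n" for k xs
    using g(2)[of "k # xs"] that by simp
  show ?thesis
    by (rule computable_cong[OF recursive_fn_computable[OF recursive_fn.minim[OF g(1)]]])
      (use ex g0 in auto)
qed

lemma computable_div: "computable n a \<Longrightarrow> computable n b \<Longrightarrow> computable n (\<lambda>xs. a xs div b xs)"
proof -
  assume ab: "computable n a" "computable n b"
  have e: "(LEAST k. b = 0 \<or> a < Suc k * b) = a div b" for a b :: nat
  proof (cases "b = 0")
    case False
    then have "b = 0 \<or> a < Suc k * b \<longleftrightarrow> a div b \<le> k" for k
      using div_less_iff_less_mult[of b a "Suc k"] by (simp add: less_Suc_eq_le del: mult_Suc)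
    then have "(LEAST k. b = 0 \<or> a < Suc k * b) = (LEAST k. a div b \<le> k)" by simp
    then show ?thesis by (simp add: Least_equality)
  qed (simp add: Least_equality)
  have ex: "\<exists>k. b = 0 \<or> a < Suc k * b" for a b :: nat
    by (intro exI[of _ a]) (cases b; simp)
  have "computable n (\<lambda>xs. LEAST k. b xs = 0 \<or> a xs < Suc k * b xs)"
    by (intro computable_Least ex decidable_disj decidable_eq decidable_less computable_mult
        computable_Suc computable_const computable_hd computable_weaken ab)
  then show ?thesis by (simp only: e)
qed



lemma computable_mod: "computable n a \<Longrightarrow> computable n b \<Longrightarrow> computable n (\<lambda>xs. a xs mod b xs)"
  unfolding minus_mult_div_eq_mod[symmetric]
  by (intro computable_diff computable_mult computable_div)

lemma computable_prod_encode:
  "computable n a \<Longrightarrow> computable n b \<Longrightarrow> computable n (\<lambda>xs. prod_encode (a xs, b xs))"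
  unfolding prod_encode_def triangle_def prod.case
  by (intro computable_add computable_div computable_mult computable_Suc computable_const)

lemmas computable_intros =
  computable_const computable_hd computable_Suc computable_add computable_diff computable_mult
  computable_power computable_div computable_mod computable_prod_encode
  decidable_not decidable_conj decidable_disj decidable_less decidable_eq
  decidable_all_less decidable_ex_less

lemma computable_fst_prod_decode:
  assumes c: "computable n c"
  shows "computable n (\<lambda>xs. fst (prod_decode (c xs)))"
proof -
  have ex: "\<exists>a. \<exists>b<Suc c. prod_encode (a, b) = c" for c
    using le_prod_encode_2[of "snd (prod_decode c)" "fst (prod_decode c)"]
    by (intro exI[of _ "fst (prod_decode c)"] exI[of _ "snd (prod_decode c)"])
      (simp add: less_Suc_eq_le)
  have "(LEAST a. \<exists>b<Suc c. prod_encode (a, b) = c) = fst (prod_decode c)" for c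
  proof -
    obtain b where "prod_encode (LEAST a. \<exists>b<Suc c. prod_encode (a, b) = c, b) = c"
      using LeastI_ex[OF ex[of c]] by blast
    from arg_cong[OF this, of "\<lambda>d. fst (prod_decode d)"] show ?thesis
      by (simp only: prod_encode_inverse fst_conv)
  qed
  moreover have "computable n (\<lambda>xs. LEAST a. \<exists>b<Suc (c xs). prod_encode (a, b) = c xs)"
    by (intro computable_Least ex computable_intros computable_weaken c)
  ultimately show ?thesis by (simp only:)
qed

lemma computable_snd_prod_decode:
  assumes c: "computable n c"
  shows "computable n (\<lambda>xs. snd (prod_decode (c xs)))"
proof -
  have ex: "\<exists>b. prod_encode (fst (prod_decode c), b) = c" for c
    by (rule exI[of _ "snd (prod_decode c)"]) simp
  have "(LEAST b. prod_encode (fst (prod_decode c), b) = c) = snd (prod_decode c)" for c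
    using LeastI_ex[OF ex[of c]] by (metis snd_conv prod_encode_inverse)
  moreover have "computable n (\<lambda>xs. LEAST b. prod_encode (fst (prod_decode (c xs)), b) = c xs)"
    by (intro computable_Least ex computable_intros computable_fst_prod_decode computable_weaken c)
  ultimately show ?thesis by (simp only:)
qed

text \<open>
  \<open>list_encode (x # xs)\<close> is the successor of a pair, so the tail of a code is obtained by subtracting
  one and projecting.
\<close>

definition list_code_nth :: "nat \<Rightarrow> nat \<Rightarrow> nat" where
  "list_code_nth c i =
    fst (prod_decode (rec_nat c (\<lambda>_ d. snd (prod_decode (d - 1))) i - 1))"

lemma list_code_nth_list_encode:
  assumes "i < length xs"
  shows "list_code_nth (list_encode xs) i = xs ! i"
proof -
  have "rec_nat (list_encode xs) (\<lambda>_ d. snd (prod_decode (d - 1))) i = list_encode (drop i xs)"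
    using assms
  proof (induction i)
    case (Suc i)
    then show ?case using Cons_nth_drop_Suc[of i xs, symmetric] by simp
  qed simp
  then show ?thesis
    using Cons_nth_drop_Suc[OF assms, symmetric] by (simp add: list_code_nth_def)
qed

lemma computable_list_code_nth:
  "computable n c \<Longrightarrow> computable n i \<Longrightarrow> computable n (\<lambda>xs. list_code_nth (c xs) (i xs))"
  unfolding list_code_nth_def
  by (intro computable_intros computable_rec_nat computable_fst_prod_decode
      computable_snd_prod_decode computable_weaken)

definition digit :: "nat \<Rightarrow> nat \<Rightarrow> nat \<Rightarrow> nat" where
  "digit b x k = x div b ^ k mod b"

lemma digit_less: "0 < b \<Longrightarrow> digit b x k < b"
  by (simp add: digit_def)

lemma computable_digit:
  "computable n b \<Longrightarrow> computable n a \<Longrightarrow> computable n k \<Longrightarrow>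
    computable n (\<lambda>xs. digit (b xs) (a xs) (k xs))"
  unfolding digit_def by (intro computable_intros)

lemma ex_digits:
  assumes "\<forall>k<n. f k < b"
  shows "\<exists>x<b ^ n. \<forall>k<n. digit b x k = f k"
  using assms
proof (induction n arbitrary: f)
  case (Suc n)
  obtain x where x: "x < b ^ n" "\<forall>k<n. digit b x k = f (Suc k)"
    using Suc.IH[of "\<lambda>k. f (Suc k)"] Suc.prems by auto
  have f0: "f 0 < b" using Suc.prems by simp
  \<comment> \<open>The least significant digit goes in front, Horner style.\<close>
  define y where "y = f 0 + b * x"
  have "y < b * Suc x" using f0 by (simp add: y_def)
  also have "\<dots> \<le> b ^ Suc n" using x(1) by (simp only: power_Suc) (intro mult_left_mono, auto)
  finally have "y < b ^ Suc n" .
  moreover have "digit b y 0 = f 0" using f0 by (simp add: digit_def y_def)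
  moreover have "digit b y (Suc k) = digit b x k" for k
    using f0 by (simp add: digit_def y_def div_mult2_eq)
  ultimately show ?case using x(2) by (metis less_Suc_eq_0_disj)
qed simp



section \<open>Invariant families of words and their runs\<close>

text \<open>
  The section of \<open>q\<close> at the prefix of length \<open>t\<close>: the state by which \<open>q\<close> acts on the remaining letters.
\<close>

primrec section_along :: "('q, 'a) transducer \<Rightarrow> 'q \<Rightarrow> 'a stream \<Rightarrow> nat \<Rightarrow> 'q" where
  "section_along T q v 0 = q"
| "section_along T q v (Suc t) = step T (section_along T q v t) (v !! t)"

lemma section_along_stl:
  "section_along T q v (Suc t) = section_along T (step T q (shd v)) (stl v) t"
  by (induction t) simp_all

lemma snth_stream_action_section:
  "stream_action T q v !! t = emit T (section_along T q v t) (v !! t)"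
proof (induction t arbitrary: q v)
  case (Suc t)
  then show ?case by (simp add: section_along_stl del: section_along.simps(2))
qed simp

text \<open>
  Here \<open>a t i\<close> is the \<open>t\<close>-th letter of the \<open>i\<close>-th word and \<open>\<sigma> t q i\<close> the section of \<open>q\<close> at its
  first \<open>t\<close> letters. The last condition says that \<open>q\<close> sends the \<open>i\<close>-th word to the word with
  index \<open>\<pi> q i\<close>, as far as the first \<open>N\<close> letters go.
\<close>

definition invariant_run ::
  "('q, 'a) transducer \<Rightarrow> nat \<Rightarrow> nat \<Rightarrow> ('q \<Rightarrow> nat \<Rightarrow> nat) \<Rightarrow> (nat \<Rightarrow> nat \<Rightarrow> 'a) \<Rightarrow>
    (nat \<Rightarrow> 'q \<Rightarrow> nat \<Rightarrow> 'q) \<Rightarrow> bool" where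
  "invariant_run T l N \<pi> a \<sigma> \<longleftrightarrow>
    (\<forall>q\<in>states T. \<forall>i<l. \<sigma> 0 q i = q \<and> \<pi> q i < l) \<and>
    (\<forall>t<N. \<forall>i<l. a t i \<in> letters T) \<and>
    (\<forall>t<N. \<forall>q\<in>states T. \<forall>i<l.
      \<sigma> (Suc t) q i = step T (\<sigma> t q i) (a t i) \<and>
      emit T (\<sigma> t q i) (a t i) = a t (\<pi> q i))"

lemma invariant_run_section_in_states:
  assumes "is_transducer T" "invariant_run T l N \<pi> a \<sigma>" "q \<in> states T" "i < l" "t \<le> N"
  shows "\<sigma> t q i \<in> states T"
  using assms(5)
proof (induction t)
  case 0
  then show ?case using assms by (simp add: invariant_run_def)
next
  case (Suc t)
  then show ?case using assms by (simp add: invariant_run_def is_transducer_def)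
qed

lemma invariant_family_iff_runs:
  assumes "is_transducer T"
  shows "(\<exists>\<pi> v. (\<forall>i<l. v i \<in> streams (letters T)) \<and>
      (\<forall>q\<in>states T. \<forall>i<l. \<pi> q i < l \<and> stream_action T q (v i) = v (\<pi> q i))) \<longleftrightarrow>
    (\<exists>\<pi> a \<sigma>. \<forall>N. invariant_run T l N \<pi> a \<sigma>)" (is "?family \<longleftrightarrow> ?runs")
proof
  assume ?family
  then obtain \<pi> v where v: "\<forall>i<l. v i \<in> streams (letters T)"
      "\<forall>q\<in>states T. \<forall>i<l. \<pi> q i < l \<and> stream_action T q (v i) = v (\<pi> q i)"
    by blast
  have "invariant_run T l N \<pi> (\<lambda>t i. v i !! t) (\<lambda>t q i. section_along T q (v i) t)" for N
    using v unfolding invariant_run_def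
    by (auto simp: streams_iff_snth simp flip: snth_stream_action_section)
  then show ?runs by blast
next
  assume ?runs
  then obtain \<pi> a \<sigma> where run: "\<And>N. invariant_run T l N \<pi> a \<sigma>" by blast
  define v where "v i = smap (\<lambda>t. a t i) nats" for i
  have nth_v: "v i !! t = a t i" for i t by (simp add: v_def)
  have a: "a t i \<in> letters T" if "i < l" for t i
    using run[of "Suc t"] that by (simp add: invariant_run_def)
  have rec: "\<sigma> (Suc t) q i = step T (\<sigma> t q i) (a t i)" "emit T (\<sigma> t q i) (a t i) = a t (\<pi> q i)"
    if "q \<in> states T" "i < l" for t q i
    using run[of "Suc t"] that by (simp_all add: invariant_run_def)
  have init: "\<sigma> 0 q i = q" "\<pi> q i < l" if "q \<in> states T" "i < l" for q i
    using run[of 0] that by (simp_all add: invariant_run_def)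
  have sec: "section_along T q (v i) t = \<sigma> t q i" if "q \<in> states T" "i < l" for q i t
    using that by (induction t) (simp_all add: rec init nth_v)
  have "stream_action T q (v i) = v (\<pi> q i)" if "q \<in> states T" "i < l" for q i
  proof -
    have "stream_action T q (v i) !! t = v (\<pi> q i) !! t" for t
      using that by (simp add: snth_stream_action_section sec rec nth_v)
    then show ?thesis by (metis stream.map_cong0 stream_smap_nats)
  qed
  then show ?family
    using a init by (intro exI[of _ \<pi>] exI[of _ v]) (auto simp: streams_iff_snth nth_v)
qed

text \<open>
  The time at which a clock stands that is put back to \<open>t1\<close> whenever it is about to reach \<open>t2\<close>.
\<close>

primrec looped_time :: "nat \<Rightarrow> nat \<Rightarrow> nat \<Rightarrow> nat" where
  "looped_time t1 t2 0 = 0"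
| "looped_time t1 t2 (Suc t) =
    (if Suc (looped_time t1 t2 t) = t2 then t1 else Suc (looped_time t1 t2 t))"

lemma looped_time_less: "t1 < t2 \<Longrightarrow> looped_time t1 t2 t < t2"
  by (induction t) auto

text \<open>
  The conditions of a run only link time \<open>t\<close> to time \<open>Suc t\<close>. When the sections agree at \<open>t1\<close> and \<open>t2\<close>,
  putting the clock back from \<open>t2\<close> to \<open>t1\<close> respects these links.
\<close>

lemma invariant_run_loop:
  assumes run: "invariant_run T l N \<pi> a \<sigma>" and t: "t1 < t2" "t2 \<le> N"
    and eq: "\<And>q i. q \<in> states T \<Longrightarrow> i < l \<Longrightarrow> \<sigma> t1 q i = \<sigma> t2 q i"
  shows "invariant_run T l M \<pi> (\<lambda>t. a (looped_time t1 t2 t)) (\<lambda>t. \<sigma> (looped_time t1 t2 t))"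
proof -
  let ?p = "looped_time t1 t2"
  have p: "?p t < N" for t using looped_time_less[OF t(1)] t(2) by (rule less_le_trans)
  have "\<sigma> (?p (Suc t)) q i = \<sigma> (Suc (?p t)) q i" if "q \<in> states T" "i < l" for t q i
    using eq[OF that] by simp
  then show ?thesis
    using run p unfolding invariant_run_def by (simp del: looped_time.simps(2))
qed

text \<open>
  There are \<open>N + 1\<close> times \<open>0, \<dots>, N\<close> but only \<open>N\<close> matrices of sections, where \<open>N\<close> is the length of
  the run; some matrix repeats.
\<close>

lemma invariant_run_pumping:
  assumes T: "is_transducer T"
    and run: "invariant_run T l (card (states T) ^ (card (states T) * l)) \<pi> a \<sigma>"
  shows "\<exists>a' \<sigma>'. \<forall>M. invariant_run T l M \<pi> a' \<sigma>'"
proof -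
  let ?N = "card (states T) ^ (card (states T) * l)"
  let ?E = "(states T \<times> {..<l}) \<rightarrow>\<^sub>E states T"
  let ?c = "\<lambda>t. restrict (\<lambda>(q, i). \<sigma> t q i) (states T \<times> {..<l})"
  have fin: "finite (states T)" using T by (simp add: is_transducer_def)
  have sub: "?c ` {..?N} \<subseteq> ?E"
    using invariant_run_section_in_states[OF T run]
    by (intro image_subsetI restrict_PiE_iff[THEN iffD2]) auto
  have "card ?E = ?N" using fin by (simp add: card_PiE card_cartesian_product)
  then have "card (?c ` {..?N}) < card {..?N}"
    using card_mono[OF _ sub] fin by (simp add: finite_PiE)
  then obtain t1 t2 where t: "t1 \<le> ?N" "t2 \<le> ?N" "t1 \<noteq> t2" "?c t1 = ?c t2"
    using pigeonhole[of ?c "{..?N}"] by (auto simp: inj_on_def)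
  have eq: "\<sigma> t1 q i = \<sigma> t2 q i" if "q \<in> states T" "i < l" for q i
    using fun_cong[OF t(4), of "(q, i)"] that by simp
  show ?thesis
  proof (cases "t1 < t2")
    case True
    then show ?thesis using invariant_run_loop[OF run True t(2)] eq by blast
  next
    case False
    then have "t2 < t1" using t(3) by simp
    then show ?thesis using invariant_run_loop[OF run _ t(1)] eq by metis
  qed
qed

section \<open>Small orbits and invariant families\<close>

lemma boundary_action_generator_in_orbit:
  assumes T: "invertible_transducer T" and v: "v \<in> streams (letters T)" and q: "q \<in> states T"
    and w: "w \<in> orbit (automaton_group T) (boundary_action T) v"
  shows "stream_action T q w \<in> orbit (automaton_group T) (boundary_action T) v"
proof -
  let ?G = "automaton_group T"
  interpret G: group ?G by (rule group_automaton_group)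
  obtain g where g: "g \<in> carrier ?G" "w = boundary_action T g v"
    using w by (auto simp: orbit_def)
  have s: "state_perm T q \<in> carrier ?G"
    using q by (auto simp: carrier_automaton_group[OF T] intro: generate.incl)
  have "w \<in> streams (letters T)"
    using g v automaton_group_tree_map[OF T] boundary_action_in_streams by blast
  then have "stream_action T q w = boundary_action T (state_perm T q \<otimes>\<^bsub>?G\<^esub> g) v"
    using boundary_action_state boundary_action_mult[OF T s g(1) v] g(2) by metis
  then show ?thesis using s g(1) by (auto simp: orbit_def)
qed

text \<open>
  Closure under the states suffices, although the group also contains their inverses: an injective
  map of a finite set into itself is onto. This is where finiteness of \<open>S\<close> enters.
\<close>

lemma orbit_subset_of_invariant:
  assumes T: "invertible_transducer T" and S: "finite S" "S \<subseteq> streams (letters T)"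
    and inv: "\<And>q w. q \<in> states T \<Longrightarrow> w \<in> S \<Longrightarrow> stream_action T q w \<in> S" and v: "v \<in> S"
  shows "orbit (automaton_group T) (boundary_action T) v \<subseteq> S"
proof -
  let ?B = "BijGroup (lists (letters T))"
  let ?G = "automaton_group T"
  interpret G: group ?G by (rule group_automaton_group)
  have one_eq: "\<one>\<^bsub>?G\<^esub> = \<one>\<^bsub>?B\<^esub>" and mult: "mult ?G = mult ?B"
    by (simp_all add: automaton_group_def)
  have carrier: "carrier ?G = generate ?B (state_perm T ` states T)"
    by (rule carrier_automaton_group[OF T])
  have "boundary_action T g ` S \<subseteq> S" if "g \<in> generate ?B (state_perm T ` states T)" for g
    using that
  proof (induction rule: generate.induct)
    case one
    show ?case using S(2) by (auto simp: boundary_action_one one_eq[symmetric])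
  next
    case (incl h)
    then show ?case using S(2) inv by (auto simp: boundary_action_state)
  next
    case (inv h)
    then obtain q where q: "q \<in> states T" "h = state_perm T q" by blast
    have h: "h \<in> carrier ?G" using inv by (auto simp: carrier intro: generate.incl)
    have i: "inv\<^bsub>?B\<^esub> h = inv\<^bsub>?G\<^esub> h"
      unfolding automaton_group_def
      by (rule group.inv_subgroup_generated[OF group_BijGroup h[unfolded automaton_group_def],
            symmetric])
    have cancel: "boundary_action T (inv\<^bsub>?G\<^esub> h) (boundary_action T h w) = w" if "w \<in> S" for w
    proof -
      have w: "w \<in> streams (letters T)" using that S(2) by blast
      have "boundary_action T (inv\<^bsub>?G\<^esub> h) (boundary_action T h w) =
          boundary_action T (inv\<^bsub>?G\<^esub> h \<otimes>\<^bsub>?G\<^esub> h) w"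
        by (rule boundary_action_mult[OF T G.inv_closed[OF h] h w, symmetric])
      then show ?thesis by (simp only: G.l_inv[OF h] boundary_action_one[OF w])
    qed
    have sub: "boundary_action T h ` S \<subseteq> S"
    proof (rule image_subsetI)
      fix w assume w: "w \<in> S"
      then have "boundary_action T h w = stream_action T q w"
        unfolding q(2) using S(2) by (intro boundary_action_state) blast
      then show "boundary_action T h w \<in> S" using assms(4)[OF q(1) w] by (simp only:)
    qed
    have "inj_on (boundary_action T h) S"
      by (rule inj_on_inverseI[where g = "boundary_action T (inv\<^bsub>?G\<^esub> h)"]) (rule cancel)
    then have onto: "boundary_action T h ` S = S" by (rule endo_inj_surj[OF S(1) sub])
    have "boundary_action T (inv\<^bsub>?G\<^esub> h) w \<in> S" if "w \<in> S" for w
    proof -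
      have "w \<in> boundary_action T h ` S" unfolding onto by (rule that)
      then obtain u where "u \<in> S" "w = boundary_action T h u" by (rule imageE)
      then show ?thesis using cancel by simp
    qed
    then show ?case unfolding i by (rule image_subsetI)
  next
    case (eng g h)
    show ?case
    proof (rule image_subsetI)
      fix w assume w: "w \<in> S"
      then have "boundary_action T (g \<otimes>\<^bsub>?B\<^esub> h) w = boundary_action T g (boundary_action T h w)"
        using boundary_action_mult[OF T, of g h w] eng.hyps S(2) by (auto simp: carrier mult)
      then show "boundary_action T (g \<otimes>\<^bsub>?B\<^esub> h) w \<in> S" using eng.IH w by blast
    qed
  qed
  then show ?thesis using v by (auto simp: orbit_def carrier)
qed

lemma has_small_schreier_graph_iff_family:
  assumes T: "invertible_transducer T"
  shows "has_small_schreier_graph T l \<longleftrightarrow> 0 < nat l \<and>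
    (\<exists>\<pi> v. (\<forall>i<nat l. v i \<in> streams (letters T)) \<and>
      (\<forall>q\<in>states T. \<forall>i<nat l. \<pi> q i < nat l \<and> stream_action T q (v i) = v (\<pi> q i)))"
    (is "_ \<longleftrightarrow> 0 < ?l \<and> ?family")
proof
  assume "has_small_schreier_graph T l"
  then obtain v where v: "v \<in> streams (letters T)"
    and small: "norm_le (schreier_graph T v) l"
    by (auto simp: has_small_schreier_graph_def)
  define orb where "orb = orbit (automaton_group T) (boundary_action T) v"
  have orb: "finite orb" "int (card orb) \<le> l"
    using small by (simp_all add: norm_le_def schreier_graph_def orb_def)
  interpret G: group "automaton_group T" by (rule group_automaton_group)
  have "v \<in> orb" using boundary_action_one[OF v] G.one_closed by (force simp: orb_def orbit_def)
  then have "0 < card orb" using orb(1) by (auto simp: card_gt_0_iff)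
  then have l: "0 < ?l" "card orb \<le> ?l" using orb(2) by simp_all
  obtain f where f: "bij_betw f {..<card orb} orb"
    using ex_bij_betw_nat_finite[OF orb(1)] by (auto simp: atLeast0LessThan)
  \<comment> \<open>An orbit with fewer than \<open>l\<close> points is listed with repetitions of \<open>v\<close>.\<close>
  define e where "e i = (if i < card orb then f i else v)" for i
  have e_in: "e i \<in> orb" for i using f \<open>v \<in> orb\<close> by (auto simp: e_def bij_betw_def)
  have e_surj: "\<exists>i<?l. e i = w" if "w \<in> orb" for w
  proof -
    have "w \<in> f ` {..<card orb}" using f that by (simp add: bij_betw_def)
    then obtain i where "i < card orb" "f i = w" by auto
    then show ?thesis using l(2) by (intro exI[of _ i]) (simp add: e_def)
  qed
  have "stream_action T q (e i) \<in> orb" if "q \<in> states T" for q i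
    using boundary_action_generator_in_orbit[OF T v that] e_in by (simp add: orb_def)
  then have "\<forall>q\<in>states T. \<forall>i. \<exists>j<?l. e j = stream_action T q (e i)" by (simp add: e_surj)
  then obtain \<pi> where "\<forall>q\<in>states T. \<forall>i. \<pi> q i < ?l \<and> e (\<pi> q i) = stream_action T q (e i)"
    by metis
  moreover have "e i \<in> streams (letters T)" for i
    using e_in[of i] v automaton_group_tree_map[OF T] boundary_action_in_streams
    by (fastforce simp: orb_def orbit_def)
  ultimately show "0 < ?l \<and> ?family" using l(1) by metis
next
  assume R: "0 < ?l \<and> ?family"
  then obtain \<pi> v where v: "\<forall>i<?l. v i \<in> streams (letters T)"
      "\<forall>q\<in>states T. \<forall>i<?l. \<pi> q i < ?l \<and> stream_action T q (v i) = v (\<pi> q i)"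
    by blast
  let ?S = "v ` {..<?l}"
  have sub: "orbit (automaton_group T) (boundary_action T) (v 0) \<subseteq> ?S"
    using v R by (intro orbit_subset_of_invariant[OF T]) auto
  have "card ?S \<le> ?l" using card_image_le[of "{..<?l}" v] by simp
  then have "norm_le (schreier_graph T (v 0)) l"
    using sub card_mono[OF _ sub] R
    by (auto simp: norm_le_def schreier_graph_def intro: finite_subset)
  then show "has_small_schreier_graph T l"
    using v(1) R by (auto simp: has_small_schreier_graph_def)
qed

theorem has_small_schreier_graph_iff_run:
  assumes T: "invertible_transducer T"
  shows "has_small_schreier_graph T l \<longleftrightarrow> 0 < nat l \<and>
    (\<exists>\<pi> a \<sigma>. invariant_run T (nat l) (card (states T) ^ (card (states T) * nat l)) \<pi> a \<sigma>)"
proof -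
  have tr: "is_transducer T" using T by (simp add: invertible_transducer_def)
  show ?thesis
    unfolding has_small_schreier_graph_iff_family[OF T] invariant_family_iff_runs[OF tr]
    using invariant_run_pumping[OF tr] by meson
qed

text \<open>
  Runs are carried along a homomorphism of transducers. Only a right inverse \<open>f'\<close> of the map \<open>f\<close> on
  states is required, since the words of the new run are images of words of the old one, whereas \<open>\<pi>\<close> and the
  initial sections have to be looked up at states of the old transducer.
\<close>

lemma invariant_run_transport:
  assumes T: "is_transducer T" and run: "invariant_run T l N \<pi> a \<sigma>"
    and f': "\<And>q. q \<in> states T' \<Longrightarrow> f' q \<in> states T \<and> f (f' q) = q"
    and g: "\<And>b. b \<in> letters T \<Longrightarrow> g b \<in> letters T'"
    and hom: "\<And>q b. q \<in> states T \<Longrightarrow> b \<in> letters T \<Longrightarrow>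
      f (step T q b) = step T' (f q) (g b) \<and> g (emit T q b) = emit T' (f q) (g b)"
  shows "invariant_run T' l N (\<lambda>q. \<pi> (f' q)) (\<lambda>t i. g (a t i)) (\<lambda>t q i. f (\<sigma> t (f' q) i))"
proof -
  have \<sigma>: "\<sigma> t q i \<in> states T" if "q \<in> states T" "i < l" "t \<le> N" for t q i
    using invariant_run_section_in_states[OF T run] that by blast
  have a: "a t i \<in> letters T" if "t < N" "i < l" for t i
    using run that by (simp add: invariant_run_def)
  show ?thesis
    using run f' g unfolding invariant_run_def
    by (auto simp flip: conjunct1[OF hom] conjunct2[OF hom] simp: \<sigma> a)
qed


section \<open>Transducers given by their tables\<close>

text \<open>
  In a code, the numbers of states and letters are followed by one pair of entries for each state \<open>q\<close>
  and letter \<open>b\<close>, in row-major order; this explains the offsets \<open>2\<close> and \<open>3\<close>.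
\<close>

definition table_transducer :: "nat \<Rightarrow> (nat, nat) transducer" where
  "table_transducer c =
    \<lparr>states = {..<list_code_nth c 0},
     letters = {..<list_code_nth c 1},
     step = \<lambda>q b. list_code_nth c (2 + 2 * (q * list_code_nth c 1 + b)),
     emit = \<lambda>q b. list_code_nth c (3 + 2 * (q * list_code_nth c 1 + b))\<rparr>"

lemma position_less: "x \<in> set xs \<Longrightarrow> position xs x < length xs"
  unfolding position_def by (induction xs) auto

lemma nth_position: "x \<in> set xs \<Longrightarrow> xs ! position xs x = x"
  using position_less[of x xs] nth_length_takeWhile[of "\<lambda>y. y \<noteq> x" xs]
  by (simp add: position_def)

lemma position_nth: "distinct xs \<Longrightarrow> i < length xs \<Longrightarrow> position xs (xs ! i) = i"
  by (metis nth_position nth_mem position_less nth_eq_iff_index_eq)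

lemma nth_concat_pairs:
  assumes "k < length xs"
  shows "concat (map (\<lambda>x. [f x, g x]) xs) ! (2 * k) = f (xs ! k)"
    and "concat (map (\<lambda>x. [f x, g x]) xs) ! Suc (2 * k) = g (xs ! k)"
proof -
  have "concat (map (\<lambda>x. [f x, g x]) xs) ! (2 * k) = f (xs ! k) \<and>
    concat (map (\<lambda>x. [f x, g x]) xs) ! Suc (2 * k) = g (xs ! k)"
    using assms
  proof (induction xs arbitrary: k)
    case (Cons x xs)
    then show ?case by (cases k) auto
  qed simp
  then show "concat (map (\<lambda>x. [f x, g x]) xs) ! (2 * k) = f (xs ! k)"
    and "concat (map (\<lambda>x. [f x, g x]) xs) ! Suc (2 * k) = g (xs ! k)" by auto
qed

lemma mult_add_less:
  fixes t N j M :: nat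
  assumes "t < N" "j < M"
  shows "t * M + j < N * M"
proof -
  have "t * M + j < Suc t * M" using assms(2) by simp
  also have "\<dots> \<le> N * M" using assms(1) by (intro mult_right_mono) auto
  finally show ?thesis .
qed

lemma mult_add_div:
  fixes t j M :: nat
  assumes "j < M"
  shows "(t * M + j) div M = t"
  using assms by (intro div_nat_eqI) auto

lemma table_transducer_code:
  fixes qs :: "'q list" and as :: "'a list"
  defines "T' \<equiv> \<lambda>T :: ('q, 'a) transducer. table_transducer (transducer_code T qs as)"
  shows "states (T' T) = {..<length qs}" "letters (T' T) = {..<length as}"
    and "i < length qs \<Longrightarrow> b < length as \<Longrightarrow>
      step (T' T) i b = position qs (step T (qs ! i) (as ! b))"
    and "i < length qs \<Longrightarrow> b < length as \<Longrightarrow>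
      emit (T' T) i b = position as (emit T (qs ! i) (as ! b))"
proof -
  define rows where "rows = List.product qs as"
  define body where "body = concat (map (\<lambda>x. [position qs (step T (fst x) (snd x)),
    position as (emit T (fst x) (snd x))]) rows)"
  have code: "transducer_code T qs as = list_encode (length qs # length as # body)"
    by (simp only: transducer_code_def body_def rows_def case_prod_unfold)
  have len: "length body = 2 * length rows"
    by (simp add: body_def length_concat comp_def sum_list_triv)
  have rows: "length rows = length qs * length as" by (simp add: rows_def)
  have n: "list_code_nth (transducer_code T qs as) 0 = length qs"
    and m: "list_code_nth (transducer_code T qs as) 1 = length as"
    by (simp_all add: code list_code_nth_list_encode del: list_encode.simps)
  show "states (T' T) = {..<length qs}" "letters (T' T) = {..<length as}"
    by (simp_all only: T'_def table_transducer_def n m transducer.select_convs)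
  assume ib: "i < length qs" "b < length as"
  let ?k = "i * length as + b"
  have k: "?k < length rows" using mult_add_less[OF ib] by (simp add: rows)
  have row: "rows ! ?k = (qs ! i, as ! b)"
    using k ib unfolding rows_def rows by (subst product_nth) (simp_all add: mult_add_div)
  have "step (T' T) i b = body ! (2 * ?k)" "emit (T' T) i b = body ! Suc (2 * ?k)"
    using k by (simp_all add: T'_def table_transducer_def m[simplified] code
        list_code_nth_list_encode len numeral_3_eq_3 del: list_encode.simps)
  then show "step (T' T) i b = position qs (step T (qs ! i) (as ! b))"
    and "emit (T' T) i b = position as (emit T (qs ! i) (as ! b))"
    by (simp_all only: body_def nth_concat_pairs[OF k] row fst_conv snd_conv)
qed

lemma is_transducer_table_transducer:
  assumes "is_transducer T" "enumerates qs (states T)" "enumerates as (letters T)"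
  shows "is_transducer (table_transducer (transducer_code T qs as))"
proof -
  have "step T (qs ! i) (as ! b) \<in> set qs \<and> emit T (qs ! i) (as ! b) \<in> set as"
    if "i < length qs" "b < length as" for i b
    using assms that by (simp add: is_transducer_def enumerates_def) (metis nth_mem)
  then show ?thesis
    unfolding is_transducer_def by (simp add: table_transducer_code position_less)
qed

lemma ex_invariant_run_table_transducer:
  assumes T: "is_transducer T" and qs: "enumerates qs (states T)" and as: "enumerates as (letters T)"
  shows "(\<exists>\<pi> a \<sigma>. invariant_run (table_transducer (transducer_code T qs as)) l N \<pi> a \<sigma>) \<longleftrightarrow>
    (\<exists>\<pi> a \<sigma>. invariant_run T l N \<pi> a \<sigma>)"
    (is "?table \<longleftrightarrow> ?run")
proof -
  let ?T = "table_transducer (transducer_code T qs as)"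
  note table = table_transducer_code[where T = T and qs = qs and as = as]
  have closed: "step T q b \<in> set qs" "emit T q b \<in> set as" if "q \<in> set qs" "b \<in> set as" for q b
    using T qs as that by (auto simp: is_transducer_def enumerates_def)
  have sets: "states T = set qs" "letters T = set as" "distinct qs" "distinct as"
    using qs as by (auto simp: enumerates_def)
  show ?thesis
  proof
    assume ?table
    then obtain \<pi> a \<sigma> where run: "invariant_run ?T l N \<pi> a \<sigma>" by blast
    have "invariant_run T l N (\<lambda>q. \<pi> (position qs q)) (\<lambda>t i. as ! a t i)
        (\<lambda>t q i. qs ! \<sigma> t (position qs q) i)"
      by (rule invariant_run_transport[OF is_transducer_table_transducer[OF T qs as] run])
        (auto simp: table sets position_less nth_position closed)
    then show ?run by blast
  next
    assume ?run
    then obtain \<pi> a \<sigma> where run: "invariant_run T l N \<pi> a \<sigma>" by blast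
    have "invariant_run ?T l N (\<lambda>q. \<pi> (qs ! q)) (\<lambda>t i. position as (a t i))
        (\<lambda>t q i. position qs (\<sigma> t (qs ! q) i))"
      by (rule invariant_run_transport[OF T run])
        (auto simp: table sets position_less nth_position position_nth)
    then show ?table by blast
  qed
qed

section \<open>Runs coded by numbers\<close>

text \<open>
  The pair of a state \<open>q < n\<close> and an index \<open>i < l\<close> is the number \<open>j = q * l + i\<close>. The digits of \<open>p\<close>
  at \<open>j\<close>, of \<open>a\<close> at \<open>t * l + i\<close> and of \<open>s\<close> at \<open>t * (n * l) + j\<close> are \<open>\<pi> q i\<close>, \<open>a t i\<close> and \<open>\<sigma> t q i\<close>.
\<close>

definition digit_run :: "(nat, nat) transducer \<Rightarrow> nat \<Rightarrow> nat \<Rightarrow> nat \<Rightarrow> nat \<Rightarrow> nat \<Rightarrow> nat \<Rightarrow> nat \<Rightarrow> bool"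
  where
  "digit_run T n m l N p a s \<longleftrightarrow>
    (\<forall>j<n * l. digit n s j = j div l) \<and>
    (\<forall>t<N. \<forall>j<n * l.
      digit n s (Suc t * (n * l) + j) =
        step T (digit n s (t * (n * l) + j)) (digit m a (t * l + j mod l)) \<and>
      emit T (digit n s (t * (n * l) + j)) (digit m a (t * l + j mod l)) =
        digit m a (t * l + digit l p j))"

text \<open>
  The bounds on \<open>p\<close>, \<open>a\<close>, \<open>s\<close> are just large enough for all the digits that are read. The positivity
  of \<open>l\<close> and \<open>N\<close> guarantees that neither side holds for an empty alphabet: then \<open>a < 0\<close> is asked for.
\<close>

lemma ex_digit_run_iff:
  assumes T: "is_transducer T" "states T = {..<n}" "letters T = {..<m}" and "0 < l" "0 < N"
  shows "(\<exists>p<l ^ (n * l). \<exists>a<m ^ (N * l). \<exists>s<n ^ (Suc N * (n * l)). digit_run T n m l N p a s) \<longleftrightarrow>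
    (\<exists>\<pi> a \<sigma>. invariant_run T l N \<pi> a \<sigma>)" (is "?digits \<longleftrightarrow> ?run")
proof
  assume ?digits
  then obtain p a s where a: "a < m ^ (N * l)" and run: "digit_run T n m l N p a s" by blast
  have "0 < m" using a assms(4,5) by (cases "m = 0") (auto simp: power_0_left)
  have j: "q * l + i < n * l" "(q * l + i) div l = q" "(q * l + i) mod l = i"
    if "q < n" "i < l" for q i
    using mult_add_less[OF that] that by simp_all
  have "invariant_run T l N (\<lambda>q i. digit l p (q * l + i)) (\<lambda>t i. digit m a (t * l + i))
      (\<lambda>t q i. digit n s (t * (n * l) + (q * l + i)))"
    unfolding invariant_run_def T(2,3)
  proof (intro conjI ballI allI impI)
    fix q i assume qi: "q \<in> {..<n}" "i < l"
    then have ji: "q * l + i < n * l" "(q * l + i) div l = q" "(q * l + i) mod l = i"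
      using j by auto
    show "digit n s (0 * (n * l) + (q * l + i)) = q"
      using run ji by (simp add: digit_run_def)
    show "digit l p (q * l + i) < l" using assms(4) by (rule digit_less)
    fix t assume "t < N"
    then show "digit n s (Suc t * (n * l) + (q * l + i)) =
        step T (digit n s (t * (n * l) + (q * l + i))) (digit m a (t * l + i))"
      and "emit T (digit n s (t * (n * l) + (q * l + i))) (digit m a (t * l + i)) =
        digit m a (t * l + digit l p (q * l + i))"
      using run ji unfolding digit_run_def by metis+
  next
    fix t i
    show "digit m a (t * l + i) \<in> {..<m}" using digit_less[OF \<open>0 < m\<close>] by simp
  qed
  then show ?run by blast
next
  assume ?run
  then obtain \<pi> a \<sigma> where run: "invariant_run T l N \<pi> a \<sigma>" by blast
  have init: "\<sigma> 0 q i = q" "\<pi> q i < l" if "q < n" "i < l" for q i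
    using run that by (auto simp: invariant_run_def T)
  have a: "a t i < m" if "t < N" "i < l" for t i
    using run that by (auto simp: invariant_run_def T)
  have rec: "\<sigma> (Suc t) q i = step T (\<sigma> t q i) (a t i)" "emit T (\<sigma> t q i) (a t i) = a t (\<pi> q i)"
    if "t < N" "q < n" "i < l" for t q i
    using run that by (auto simp: invariant_run_def T)
  have \<sigma>: "\<sigma> t q i < n" if "t \<le> N" "q < n" "i < l" for t q i
    using invariant_run_section_in_states[OF T(1) run, of q i t] that by (simp add: T)
  have dm: "j div l < n" "j mod l < l" if "j < n * l" for j
    using that assms(4) by (simp_all add: less_mult_imp_div_less)
  obtain p where p: "p < l ^ (n * l)" "\<forall>j<n * l. digit l p j = \<pi> (j div l) (j mod l)"
    using ex_digits[of "n * l" "\<lambda>j. \<pi> (j div l) (j mod l)" l] init(2) dm by blast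
  obtain x where x: "x < m ^ (N * l)" "\<forall>k<N * l. digit m x k = a (k div l) (k mod l)"
    using ex_digits[of "N * l" "\<lambda>k. a (k div l) (k mod l)" m] a assms(4)
    by (auto simp: less_mult_imp_div_less)
  let ?f = "\<lambda>k. \<sigma> (k div (n * l)) (k mod (n * l) div l) (k mod (n * l) mod l)"
  have "?f k < n" if k: "k < Suc N * (n * l)" for k
  proof -
    have "k mod (n * l) < n * l" using k by (intro mod_less_divisor) (cases "n * l", auto)
    then show ?thesis using less_mult_imp_div_less[OF k] dm by (intro \<sigma>) auto
  qed
  then obtain s where s: "s < n ^ (Suc N * (n * l))" "\<forall>k<Suc N * (n * l). digit n s k = ?f k"
    using ex_digits[of "Suc N * (n * l)" ?f n] by blast
  have dp: "digit l p j = \<pi> (j div l) (j mod l)" if "j < n * l" for j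
    using p(2) that by simp
  have dx: "digit m x (t * l + i) = a t i" if "t < N" "i < l" for t i
    using x(2) mult_add_less[OF that] that by simp
  have ds: "digit n s (t * (n * l) + j) = \<sigma> t (j div l) (j mod l)" if "t < Suc N" "j < n * l" for t j
  proof -
    have "(t * (n * l) + j) div (n * l) = t" "(t * (n * l) + j) mod (n * l) = j"
      by (simp only: mult_add_div[OF that(2)]) (simp add: that(2))
    then show ?thesis using s(2) mult_add_less[OF that] by simp
  qed
  have "digit_run T n m l N p x s"
    unfolding digit_run_def
  proof (intro conjI allI impI)
    fix j assume j: "j < n * l"
    show "digit n s j = j div l" using ds[of 0 j] j dm[OF j] init by simp
    fix t assume t: "t < N"
    have d: "digit n s (t * (n * l) + j) = \<sigma> t (j div l) (j mod l)"
      "digit n s (Suc t * (n * l) + j) = \<sigma> (Suc t) (j div l) (j mod l)"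
      by (rule ds; (use t j in simp))+
    show "digit n s (Suc t * (n * l) + j) =
        step T (digit n s (t * (n * l) + j)) (digit m x (t * l + j mod l))"
      and "emit T (digit n s (t * (n * l) + j)) (digit m x (t * l + j mod l)) =
        digit m x (t * l + digit l p j)"
      unfolding d dp[OF j] by (simp_all only: dx[OF t] rec[OF t] dm[OF j] init)
  qed
  then show ?digits using p(1) x(1) s(1) by blast
qed

text \<open>
  The length of the run is the number of matrices of sections, as needed for the pumping argument.
\<close>

definition has_coded_run :: "nat \<Rightarrow> nat \<Rightarrow> bool" where
  "has_coded_run c l \<longleftrightarrow> 0 < l \<and>
    (\<exists>p<l ^ (list_code_nth c 0 * l).
     \<exists>a<list_code_nth c 1 ^ (list_code_nth c 0 ^ (list_code_nth c 0 * l) * l).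
     \<exists>s<list_code_nth c 0 ^
          (Suc (list_code_nth c 0 ^ (list_code_nth c 0 * l)) * (list_code_nth c 0 * l)).
       digit_run (table_transducer c) (list_code_nth c 0) (list_code_nth c 1) l
         (list_code_nth c 0 ^ (list_code_nth c 0 * l)) p a s)"

lemma decidable_has_coded_run:
  assumes c: "computable n c" and l: "computable n l"
  shows "decidable n (\<lambda>xs. has_coded_run (c xs) (l xs))"
  unfolding has_coded_run_def digit_run_def table_transducer_def transducer.select_convs
  by (intro computable_intros computable_digit computable_list_code_nth computable_weaken c l)

lemma has_small_schreier_graph_iff_has_coded_run:
  assumes T: "invertible_transducer T"
    and qs: "enumerates qs (states T)" and as: "enumerates as (letters T)"
  shows "has_small_schreier_graph T l \<longleftrightarrow> has_coded_run (transducer_code T qs as) (nat l)"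
proof -
  let ?c = "transducer_code T qs as"
  have tr: "is_transducer T" using T by (simp add: invertible_transducer_def)
  note table = table_transducer_code(1,2)[where T = T and qs = qs and as = as]
  have n: "list_code_nth ?c 0 = length qs" and m: "list_code_nth ?c 1 = length as"
    using table by (simp_all only: table_transducer_def transducer.select_convs lessThan_eq_iff)
  have card: "card (states T) = length qs"
    using qs distinct_card[of qs] by (auto simp: enumerates_def)
  \<comment> \<open>Without states the bound is \<open>0 ^ 0 = 1\<close>, which is still positive.\<close>
  have pos: "0 < length qs ^ (length qs * k)" for k by (cases "length qs") auto
  show ?thesis
  proof (cases "0 < nat l")
    case True
    show ?thesis
      unfolding has_small_schreier_graph_iff_run[OF T] has_coded_run_def n m card
        ex_digit_run_iff[OF is_transducer_table_transducer[OF tr qs as] table True pos]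
        ex_invariant_run_table_transducer[OF tr qs as] ..
  next
    case False
    then show ?thesis
      unfolding has_small_schreier_graph_iff_run[OF T] has_coded_run_def by blast
  qed
qed

section \<open>The decision problems\<close>

text \<open>
  \<open>int_encode\<close> sends nonnegative integers to even numbers and negative ones to odd numbers.
\<close>

lemma nat_eq_int_encode: "nat l = (1 - int_encode l mod 2) * (int_encode l div 2)"
  by (simp add: int_encode_def sum_encode_def)

lemma decidable_problemI:
  assumes "decidable 1 (\<lambda>xs. R (hd xs))" and "\<And>x. x \<in> I \<Longrightarrow> P x \<longleftrightarrow> R (enc x)"
  shows "decidable_problem I enc P"
proof -
  obtain f where "recursive_fn 1 f" "\<And>x. f [x] = of_bool (R x)"
    using assms(1) unfolding decidable_def computable_def by auto
  then show ?thesis using assms(2) unfolding decidable_problem_def by auto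
qed

theorem corollary7:
  shows "(\<forall>T :: ('q, 'a) transducer. invertible_transducer T \<longrightarrow>
      decidable_problem UNIV int_encode (\<lambda>l. has_small_schreier_graph T l)) \<and>
    decidable_problem
      {(T :: ('q, 'a) transducer, qs, as, l :: int). invertible_transducer T \<and>
        enumerates qs (states T) \<and> enumerates as (letters T)}
      (\<lambda>(T, qs, as, l). prod_encode (transducer_code T qs as, int_encode l))
      (\<lambda>(T, qs, as, l). has_small_schreier_graph T l)"
proof (intro conjI allI impI)
  have hd: "computable 1 (\<lambda>xs. hd xs)" using computable_hd[of 0] by simp
  fix T :: "('q, 'a) transducer" assume T: "invertible_transducer T"
  then have "finite (states T)" "finite (letters T)"
    by (simp_all add: invertible_transducer_def is_transducer_def)
  then obtain qs as where "enumerates qs (states T)" "enumerates as (letters T)"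
    unfolding enumerates_def by (metis finite_distinct_list)
  note small = has_small_schreier_graph_iff_has_coded_run[OF T this]
  show "decidable_problem UNIV int_encode (\<lambda>l. has_small_schreier_graph T l)"
  proof (rule decidable_problemI)
    show "decidable 1 (\<lambda>xs. has_coded_run (transducer_code T qs as)
        ((1 - hd xs mod 2) * (hd xs div 2)))"
      by (intro decidable_has_coded_run computable_intros hd)
  qed (simp only: small nat_eq_int_encode)
next
  have hd: "computable 1 (\<lambda>xs. hd xs)" using computable_hd[of 0] by simp
  show "decidable_problem
      {(T :: ('q, 'a) transducer, qs, as, l :: int). invertible_transducer T \<and>
        enumerates qs (states T) \<and> enumerates as (letters T)}
      (\<lambda>(T, qs, as, l). prod_encode (transducer_code T qs as, int_encode l))
      (\<lambda>(T, qs, as, l). has_small_schreier_graph T l)"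
  proof (rule decidable_problemI)
    show "decidable 1 (\<lambda>xs. has_coded_run (fst (prod_decode (hd xs)))
        ((1 - snd (prod_decode (hd xs)) mod 2) * (snd (prod_decode (hd xs)) div 2)))"
      by (intro decidable_has_coded_run computable_intros computable_fst_prod_decode
          computable_snd_prod_decode hd)
  qed (auto simp: has_small_schreier_graph_iff_has_coded_run nat_eq_int_encode)
qed

end
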